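(* Let $(X,\tau)$ be a topological space that is quasi-H-closed and strongly irresolvable. Then $(X,\tau)$ is p-closed.
   Context: No separation axioms are assumed. A subset $A$ of a space $(X,\tau)$ is preopen if $A \subseteq \mathrm{int}(\mathrm{cl}(A))$; it is preclosed if its complement is preopen, i.e. $\mathrm{cl}(\mathrm{int}(A)) \subseteq A$. The preclosure $\mathrm{pcl}(A)$ is the intersection of all preclosed supersets of $A$ (it is itself preclosed). $(X,\tau)$ is p-closed if for every cover $\{V_\alpha : \alpha\in A\}$ of $X$ by preopen sets there is a finite $A_0\subseteq A$ with $X=\bigcup_{\alpha\in A_0}\mathrm{pcl}(V_\alpha)$. $(X,\tau)$ is quasi-H-closed (QHC) if for every open cover $\{V_\alpha : \alpha\in A\}$ of $X$ there is a finite $A_0\subseteq A$ with $X=\bigcup_{\alpha\in A_0}\mathrm{cl}(V_\alpha)$. A space is resolvable if it is the disjoint union of two dense subsets, and irresolvable otherwise; $(X,\tau)$ is strongly irresolvable if every nonempty open subspace of $X$ is irresolvable. *)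

theory Defs
  imports "HOL-Analysis.Analysis"
begin

definition preopenin :: "'a topology \<Rightarrow> 'a set \<Rightarrow> bool" where
  "preopenin X A \<longleftrightarrow> A \<subseteq> topspace X \<and> A \<subseteq> X interior_of (X closure_of A)"

definition preclosedin :: "'a topology \<Rightarrow> 'a set \<Rightarrow> bool" where
  "preclosedin X A \<longleftrightarrow> A \<subseteq> topspace X \<and> preopenin X (topspace X - A)"

lemma preclosedin_iff:
  "preclosedin X A \<longleftrightarrow> A \<subseteq> topspace X \<and> X closure_of (X interior_of A) \<subseteq> A"
proof -
  have "topspace X - A \<subseteq> X interior_of (X closure_of (topspace X - A))
      \<longleftrightarrow> X closure_of (X interior_of A) \<subseteq> A" if "A \<subseteq> topspace X"
  proof -
    have "X interior_of (X closure_of (topspace X - A))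
        = topspace X - X closure_of (X interior_of A)"
      by (simp add: closure_of_complement interior_of_complement)
    then show ?thesis
      using closure_of_subset_topspace[of X "X interior_of A"] that by auto
  qed
  then show ?thesis
    unfolding preclosedin_def preopenin_def by blast
qed

text \<open>Only meaningful for \<open>A \<subseteq> topspace X\<close>: then \<open>topspace X\<close> itself is a preclosed superset,
  so the intersection is over a nonempty family.\<close>

definition preclosure_of :: "'a topology \<Rightarrow> 'a set \<Rightarrow> 'a set" (infixr "preclosure'_of" 80) where
  "X preclosure_of A = \<Inter>{C. preclosedin X C \<and> A \<subseteq> C}"

text \<open>Covers are given as sets of sets, as in the library's \<open>compactin\<close>.\<close>

definition p_closed_space :: "'a topology \<Rightarrow> bool" where
  "p_closed_space X \<longleftrightarrow>
    (\<forall>\<V>. (\<forall>V\<in>\<V>. preopenin X V) \<and> \<Union>\<V> = topspace X \<longrightarrow>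
      (\<exists>\<F>. finite \<F> \<and> \<F> \<subseteq> \<V> \<and> topspace X = (\<Union>V\<in>\<F>. X preclosure_of V)))"

definition quasi_H_closed_space :: "'a topology \<Rightarrow> bool" where
  "quasi_H_closed_space X \<longleftrightarrow>
    (\<forall>\<V>. (\<forall>V\<in>\<V>. openin X V) \<and> \<Union>\<V> = topspace X \<longrightarrow>
      (\<exists>\<F>. finite \<F> \<and> \<F> \<subseteq> \<V> \<and> topspace X = (\<Union>V\<in>\<F>. X closure_of V)))"

definition resolvable_space :: "'a topology \<Rightarrow> bool" where
  "resolvable_space X \<longleftrightarrow>
    (\<exists>A B. A \<union> B = topspace X \<and> A \<inter> B = {} \<and>
      X closure_of A = topspace X \<and> X closure_of B = topspace X)"

definition strongly_irresolvable_space :: "'a topology \<Rightarrow> bool" where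
  "strongly_irresolvable_space X \<longleftrightarrow>
    (\<forall>U. openin X U \<and> U \<noteq> {} \<longrightarrow> \<not> resolvable_space (subtopology X U))"

end

theory Submission
  imports Defs
begin

text \<open>
  In a strongly irresolvable space a set cannot be dense in a nonempty open region in which its
  interior is empty: there, the set and its complement would be disjoint dense subsets. Hence
  \<open>X interior_of (X closure_of A) \<subseteq> X closure_of (X interior_of A)\<close> for all \<open>A\<close>
  (\<open>interior_of_closure_of_subset_closure_of_interior_of\<close>).

  A preopen cover \<open>\<V>\<close> gives the open cover by the sets \<open>X interior_of (X closure_of V)\<close>, to which
  quasi-H-closedness applies. The closures of these sets do not exceed the preclosures of
  the \<open>V\<close>: by the inclusion above they lie in \<open>X closure_of (X interior_of V)\<close>, and every preclosed
  set that contains \<open>V\<close> contains this set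
  (\<open>closure_of_interior_of_subset_preclosure_of\<close>).
\<close>

text \<open>The difference of the two sides is an open set \<open>W\<close>. If it were nonempty, \<open>W \<inter> A\<close> and
  \<open>W - A\<close> would resolve it: \<open>A\<close> is dense in \<open>W\<close>, and no nonempty open subset of \<open>W\<close> lies inside
  \<open>A\<close>, so the complement of \<open>A\<close> is dense in \<open>W\<close> as well.\<close>

lemma interior_of_closure_of_subset_closure_of_interior_of:
  assumes "strongly_irresolvable_space X"
  shows "X interior_of (X closure_of A) \<subseteq> X closure_of (X interior_of A)"
proof (rule ccontr)
  assume not_sub: "\<not> ?thesis"
  define W where "W = X interior_of (X closure_of A) - X closure_of (X interior_of A)"
  have "openin X W"
    by (simp add: W_def openin_diff)
  then have W_sub: "W \<subseteq> topspace X"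
    by (rule openin_subset)
  have W_ne: "W \<noteq> {}"
    using not_sub by (auto simp: W_def)
  have in_dense: "W \<subseteq> X closure_of (W \<inter> A)"
  proof -
    have "W \<subseteq> X closure_of A"
      using interior_of_subset[of X "X closure_of A"] by (auto simp: W_def)
    then show ?thesis
      using openin_Int_closure_of_subset[OF \<open>openin X W\<close>, of A] by blast
  qed
  have out_dense: "W \<subseteq> X closure_of (W - A)"
  proof
    fix x assume "x \<in> W"
    have "\<exists>y. y \<in> W - A \<and> y \<in> N" if N: "x \<in> N" "openin X N" for N
    proof (rule ccontr)
      assume "\<not> ?thesis"
      then have "N \<inter> W \<subseteq> A"
        by blast
      moreover have "openin X (N \<inter> W)"
        using N \<open>openin X W\<close> by blast
      ultimately have "N \<inter> W \<subseteq> X interior_of A"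
        by (rule interior_of_maximal)
      then have "x \<in> X interior_of A"
        using N \<open>x \<in> W\<close> by blast
      then have "x \<in> X closure_of (X interior_of A)"
        using closure_of_subset[OF interior_of_subset_topspace[of X A]] by blast
      then show False
        using \<open>x \<in> W\<close> by (simp add: W_def)
    qed
    then show "x \<in> X closure_of (W - A)"
      using \<open>x \<in> W\<close> W_sub by (auto simp: in_closure_of)
  qed
  have "resolvable_space (subtopology X W)"
    unfolding resolvable_space_def
  proof (intro exI conjI)
    have top_W: "topspace (subtopology X W) = W"
      using W_sub by auto
    show "(W \<inter> A) \<union> (W - A) = topspace (subtopology X W)"
      using top_W by blast
    show "(W \<inter> A) \<inter> (W - A) = {}"
      by blast
    show "subtopology X W closure_of (W \<inter> A) = topspace (subtopology X W)"
      unfolding top_W closure_of_subtopology using in_dense by (auto simp: Int_absorb1)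
    have "W \<inter> (W - A) = W - A"
      by blast
    then show "subtopology X W closure_of (W - A) = topspace (subtopology X W)"
      unfolding top_W closure_of_subtopology using out_dense by auto
  qed
  then show False
    using assms \<open>openin X W\<close> W_ne by (auto simp: strongly_irresolvable_space_def)
qed

text \<open>A preclosed set contains the closure of its own interior, and the interior is monotone.\<close>

lemma closure_of_interior_of_subset_preclosure_of:
  "X closure_of (X interior_of A) \<subseteq> X preclosure_of A"
  unfolding preclosure_of_def
proof (rule Inter_greatest)
  fix C assume "C \<in> {C. preclosedin X C \<and> A \<subseteq> C}"
  then have C: "X closure_of (X interior_of C) \<subseteq> C" "A \<subseteq> C"
    by (simp_all add: preclosedin_iff)
  from C(2) have "X closure_of (X interior_of A) \<subseteq> X closure_of (X interior_of C)"
    by (intro closure_of_mono interior_of_mono)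
  with C(1) show "X closure_of (X interior_of A) \<subseteq> C"
    by blast
qed

lemma preclosure_of_subset_topspace:
  assumes "A \<subseteq> topspace X"
  shows "X preclosure_of A \<subseteq> topspace X"
proof -
  have "preclosedin X (topspace X)"
    by (simp add: preclosedin_iff closure_of_subset_topspace)
  with assms show ?thesis
    unfolding preclosure_of_def by blast
qed

theorem theorem2p1:
  fixes X :: "'a topology"
  assumes "quasi_H_closed_space X"
    and "strongly_irresolvable_space X"
  shows "p_closed_space X"
  unfolding p_closed_space_def
proof (intro allI impI, elim conjE)
  fix \<V> assume preopen: "\<forall>V\<in>\<V>. preopenin X V" and cover: "\<Union>\<V> = topspace X"
  let ?U = "\<lambda>V. X interior_of (X closure_of V)"
  have "\<Union>(?U ` \<V>) = topspace X"
  proof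
    show "\<Union>(?U ` \<V>) \<subseteq> topspace X"
      using interior_of_subset_topspace[of X] by blast
    show "topspace X \<subseteq> \<Union>(?U ` \<V>)"
    proof
      fix x assume "x \<in> topspace X"
      then obtain V where "V \<in> \<V>" "x \<in> V"
        using cover by blast
      with preopen show "x \<in> \<Union>(?U ` \<V>)"
        by (auto simp: preopenin_def)
    qed
  qed
  moreover have "\<forall>U\<in>?U ` \<V>. openin X U"
    by auto
  ultimately obtain \<G> where \<G>: "finite \<G>" "\<G> \<subseteq> ?U ` \<V>" "topspace X = (\<Union>U\<in>\<G>. X closure_of U)"
    using assms(1)[unfolded quasi_H_closed_space_def, rule_format, of "?U ` \<V>"] by blast
  from finite_subset_image[OF \<G>(1,2)] obtain \<F>
    where \<F>: "finite \<F>" "\<F> \<subseteq> \<V>" "\<G> = ?U ` \<F>"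
    by blast
  have U_sub: "X closure_of ?U V \<subseteq> X preclosure_of V" for V
  proof -
    have "X closure_of ?U V \<subseteq> X closure_of (X interior_of V)"
      using interior_of_closure_of_subset_closure_of_interior_of[OF assms(2), of V]
      by (rule closure_of_minimal) simp
    then show ?thesis
      using closure_of_interior_of_subset_preclosure_of by (rule order_trans)
  qed
  have "topspace X \<subseteq> (\<Union>V\<in>\<F>. X preclosure_of V)"
    unfolding \<G>(3) \<F>(3) using U_sub by blast
  moreover have "(\<Union>V\<in>\<F>. X preclosure_of V) \<subseteq> topspace X"
  proof (rule UN_least)
    fix V assume "V \<in> \<F>"
    with \<F>(2) preopen have "V \<subseteq> topspace X"
      by (auto simp: preopenin_def)
    then show "X preclosure_of V \<subseteq> topspace X"
      by (rule preclosure_of_subset_topspace)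
  qed
  ultimately show "\<exists>\<F>. finite \<F> \<and> \<F> \<subseteq> \<V> \<and> topspace X = (\<Union>V\<in>\<F>. X preclosure_of V)"
    using \<F>(1,2) by blast
qed

end
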